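(* Let $m\ge 1$ be an integer, let $x_1,\dots,x_m$ be elements of a commutative ring, and let $D_m(x_1,\dots,x_m)$ be the $m\times m$ matrix whose $(p,q)$ entry is $x_{\max(m+1-p,\,q)}$ for $1\le p,q\le m$. Then $$\det D_m(x_1,\dots,x_m)=\begin{cases}(-1)^{\frac{m}{2}}\prod_{i=1}^{m}(x_i-x_{i+1}), & \text{if } m \text{ is even},\\[2pt] (-1)^{\frac{m-1}{2}}\prod_{i=1}^{m}(x_i-x_{i+1}), & \text{if } m \text{ is odd},\end{cases}$$ where $x_{m+1}=0$.
   Context: The matrix is, explicitly, $$D_m(x_1,\dots,x_m)=\begin{pmatrix} x_m & x_m & \cdots & x_m & x_m\\ x_{m-1} & x_{m-1} & \cdots & x_{m-1} & x_m\\ \vdots&\vdots&\ddots&\vdots&\vdots\\ x_2 & x_2 & \cdots & x_{m-1} & x_m\\ x_1 & x_2&\cdots & x_{m-1} & x_m\end{pmatrix}.$$ *)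

theory Defs
  imports "Jordan_Normal_Form.Determinant"
begin

text \<open>Library matrices are indexed from \<open>0\<close>, so the entry at \<open>(i, j)\<close> is the paper's
  entry at \<open>(p, q) = (i + 1, j + 1)\<close>. The sequence \<open>x\<close> is indexed from \<open>1\<close>; only
  \<open>x 1, \<dots>, x m\<close> occur.\<close>

definition D_mat :: "nat \<Rightarrow> (nat \<Rightarrow> 'a) \<Rightarrow> 'a mat" where
  "D_mat m x = mat m m (\<lambda>(i, j). let p = i + 1; q = j + 1 in x (max (m + 1 - p) q))"

end

theory Submission
  imports Defs
begin

text \<open>Put \<open>d k = x k - x (k + 1)\<close> with \<open>x (m + 1) = 0\<close>. Telescoping gives
  \<open>x (max a b) = (\<Sum>k = max a b..m. d k)\<close>, a sum over those \<open>k \<le> m\<close> that satisfy both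
  \<open>a \<le> k\<close> and \<open>b \<le> k\<close>. Hence the matrix is a product of a matrix vanishing above the
  anti-diagonal, with anti-diagonal entries \<open>d k\<close>, and a lower unitriangular one.\<close>

text \<open>Laplace expansion along row \<open>0\<close> leaves one term, in the last column
  \<open>n\<close>. Its minor has the same shape with rows shifted by one, and its sign
  \<open>(- 1) ^ n\<close> turns the exponent \<open>n div 2\<close> into
  \<open>Suc n div 2\<close>.\<close>

lemma det_anti_triangular:
  fixes f :: "nat \<Rightarrow> nat \<Rightarrow> 'a :: comm_ring_1"
  assumes "\<And>i j. i + j + 1 < n \<Longrightarrow> f i j = 0"
  shows "det (mat n n (\<lambda>(i, j). f i j)) = (- 1) ^ (n div 2) * (\<Prod>k<n. f (n - 1 - k) k)"
  using assms
proof (induction n arbitrary: f)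
  case 0
  show ?case by simp
next
  case (Suc n)
  define A where "A = mat (Suc n) (Suc n) (\<lambda>(i, j). f i j)"
  have minor: "mat_delete A 0 n = mat n n (\<lambda>(i, j). f (Suc i) j)"
    by (rule eq_matI) (auto simp: A_def mat_delete_def)
  have IH: "det (mat n n (\<lambda>(i, j). f (Suc i) j)) =
      (- 1) ^ (n div 2) * (\<Prod>k<n. f (Suc (n - 1 - k)) k)"
    by (rule Suc.IH) (simp add: Suc.prems)
  have "det A = (\<Sum>j<Suc n. A $$ (0, j) * cofactor A 0 j)"
    by (rule laplace_expansion_row) (auto simp: A_def)
  also have "\<dots> = f 0 n * cofactor A 0 n"
    by (simp add: A_def Suc.prems)
  also have "\<dots> = (- 1) ^ n * (- 1) ^ (n div 2) * (f 0 n * (\<Prod>k<n. f (Suc (n - 1 - k)) k))"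
    by (simp add: cofactor_def minor IH algebra_simps)
  also have "(- 1 :: 'a) ^ n * (- 1) ^ (n div 2) = (- 1) ^ (Suc n div 2)"
    by (cases "even n") (auto elim!: evenE oddE)
  also have "f 0 n * (\<Prod>k<n. f (Suc (n - 1 - k)) k) = (\<Prod>k<Suc n. f (Suc n - 1 - k) k)"
    by (simp add: Suc_diff_Suc mult.commute)
  finally show ?case
    by (simp add: A_def)
qed

theorem proposition1p4:
  fixes x :: "nat \<Rightarrow> 'a :: comm_ring_1" and m :: nat
  assumes "m \<ge> 1"
  shows "det (D_mat m x) =
    (let y = x(m + 1 := 0) in
      if even m then (- 1) ^ (m div 2) * (\<Prod>i = 1..m. y i - y (i + 1))
      else (- 1) ^ ((m - 1) div 2) * (\<Prod>i = 1..m. y i - y (i + 1)))"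
proof -
  define y where "y = x(m + 1 := 0)"
  \<comment> \<open>The shift by one matches the differences, numbered from 1, with matrix indices
    starting at 0.\<close>
  define d where "d k = y (Suc k) - y (Suc (Suc k))" for k
  \<comment> \<open>For \<open>i < m\<close> the condition means \<open>m - Suc i \<le> k\<close>.
    Together with \<open>j \<le> k\<close> from \<open>L\<close> it leaves in entry
    \<open>(i, j)\<close> of the product exactly the \<open>k\<close> from the maximum of both
    bounds upwards.\<close>
  define A where "A = mat m m (\<lambda>(i, k). if m \<le> i + k + 1 then d k else 0)"
  define L where "L = mat m m (\<lambda>(k, j). if j \<le> k then 1 else 0 :: 'a)"
  have telescope: "(\<Sum>k = a..<m. d k) = y (Suc a)" if "a \<le> m" for a
    using that
  proof (induction rule: inc_induct)
    case base
    show ?case by (simp add: y_def)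
  next
    case (step n)
    then show ?case by (simp add: sum.atLeast_Suc_lessThan d_def)
  qed
  have "D_mat m x = A * L"
  proof (rule eq_matI)
    fix i j
    assume "i < dim_row (A * L)" and "j < dim_col (A * L)"
    then have ij: "i < m" "j < m"
      by (simp_all add: A_def L_def)
    let ?a = "max (m - Suc i) j"
    have "(A * L) $$ (i, j) = (\<Sum>k = 0..<m. if ?a \<le> k then d k else 0)"
      using ij by (auto simp: A_def L_def scalar_prod_def intro!: sum.cong)
    also have "\<dots> = (\<Sum>k = ?a..<m. d k)"
      by (intro sum.mono_neutral_cong_right) auto
    also have "\<dots> = y (Suc ?a)"
      using ij by (intro telescope) auto
    also have "\<dots> = D_mat m x $$ (i, j)"
    proof -
      \<comment> \<open>The inequality keeps the index off the position where \<open>y\<close> was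
        set to 0, so \<open>y\<close> agrees with \<open>x\<close> there.\<close>
      have "Suc ?a = max (m - i) (Suc j)" "Suc ?a \<noteq> m + 1"
        using ij by auto
      then show ?thesis
        using ij by (simp add: D_mat_def y_def)
    qed
    finally show "D_mat m x $$ (i, j) = (A * L) $$ (i, j)" ..
  qed (simp_all add: D_mat_def A_def L_def)
  moreover have "det L = 1"
  proof -
    have "det L = prod_list (diag_mat L)"
      by (rule det_lower_triangular[where n = m]) (auto simp: L_def)
    also have "diag_mat L = replicate m 1"
      by (auto simp: diag_mat_def L_def intro!: nth_equalityI)
    finally show ?thesis by simp
  qed
  moreover have "det A = (- 1) ^ (m div 2) * (\<Prod>k<m. d k)"
    unfolding A_def by (subst det_anti_triangular) auto
  moreover have "(\<Prod>k<m. d k) = (\<Prod>i = 1..m. y i - y (i + 1))"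
    by (rule prod.reindex_bij_witness[of _ "\<lambda>i. i - 1" Suc]) (auto simp: d_def)
  moreover have "det (A * L) = det A * det L"
    by (rule det_mult[where n = m]) (simp_all add: A_def L_def)
  \<comment> \<open>This merges the two parity cases of the claim into the single sign
    \<open>(- 1) ^ (m div 2)\<close>.\<close>
  moreover have "(m - 1) div 2 = m div 2" if "odd m"
    using that by presburger
  ultimately show ?thesis
    unfolding y_def[symmetric] Let_def by simp
qed

end
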